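(* Let $X$ be a small category and $P$ a category over $X$. The fibers over $x\in X$ of the reflections ${\downarrow}P$ and ${\uparrow}P$ of $P$ in discrete fibrations and in discrete opfibrations, respectively, have the form $$({\downarrow}P)x\cong\mathrm{ten}({\uparrow}x,P),\qquad ({\uparrow}P)x\cong\mathrm{ten}({\downarrow}x,P).$$
   Context: $\mathbf{Cat}/X$ is the slice category: objects ("categories over $X$") are functors $\pi:P\to X$ with $P$ small (denoted simply $P$), morphisms are functors commuting with the projections to $X$. $P$ is a discrete fibration if for every object $a$ of $P$ and every arrow $f:y\to\pi a$ of $X$ there is a unique arrow of $P$ with codomain $a$ lying over $f$; a discrete opfibration is defined dually. $\overleftarrow{X}$ and $\overrightarrow{X}$ denote the full subcategories of $\mathbf{Cat}/X$ given by discrete fibrations and discrete opfibrations. ${\downarrow}(-):\mathbf{Cat}/X\to\overleftarrow{X}$ and ${\uparrow}(-):\mathbf{Cat}/X\to\overrightarrow{X}$ are the left adjoints of the inclusions (which exist). An object $x$ of $X$ is regarded as the category $x:\mathbf{1}\to X$ over $X$; its reflections are the slices ${\downarrow}x\cong X/x$ and ${\uparrow}x\cong x/X$, with their canonical projections to $X$. For a discrete (op)fibration $A$, $Ax$ is the set of objects of $A$ over $x$. For $P,Q\in\mathbf{Cat}/X$, $\mathrm{ten}(P,Q)$ is the set of connected components of the total category of the product $P\times Q$ in $\mathbf{Cat}/X$ (i.e. of the pullback $P\times_X Q$). *)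

theory Defs
  imports "HOL-Library.Equipollence" "HOL-Library.Infinite_Typeclass"
begin

text \<open>
  The composite \<open>g \<circ> f\<close> is \<open>Comp C g f\<close>; all fields are relevant only on the carriers
  \<open>Obj C\<close> and \<open>Arr C\<close>.
\<close>

record ('o, 'a) cat =
  Obj :: "'o set"
  Arr :: "'a set"
  Dom :: "'a \<Rightarrow> 'o"
  Cod :: "'a \<Rightarrow> 'o"
  Ide :: "'o \<Rightarrow> 'a"
  Comp :: "'a \<Rightarrow> 'a \<Rightarrow> 'a"

locale category =
  fixes C :: "('o, 'a) cat"
  assumes dom_obj: "f \<in> Arr C \<Longrightarrow> Dom C f \<in> Obj C"
    and cod_obj: "f \<in> Arr C \<Longrightarrow> Cod C f \<in> Obj C"
    and ide_arr: "x \<in> Obj C \<Longrightarrow> Ide C x \<in> Arr C"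
    and dom_ide: "x \<in> Obj C \<Longrightarrow> Dom C (Ide C x) = x"
    and cod_ide: "x \<in> Obj C \<Longrightarrow> Cod C (Ide C x) = x"
    and comp_arr: "\<lbrakk>f \<in> Arr C; g \<in> Arr C; Dom C g = Cod C f\<rbrakk> \<Longrightarrow> Comp C g f \<in> Arr C"
    and dom_comp: "\<lbrakk>f \<in> Arr C; g \<in> Arr C; Dom C g = Cod C f\<rbrakk> \<Longrightarrow> Dom C (Comp C g f) = Dom C f"
    and cod_comp: "\<lbrakk>f \<in> Arr C; g \<in> Arr C; Dom C g = Cod C f\<rbrakk> \<Longrightarrow> Cod C (Comp C g f) = Cod C g"
    and comp_ide_right: "f \<in> Arr C \<Longrightarrow> Comp C f (Ide C (Dom C f)) = f"
    and comp_ide_left: "f \<in> Arr C \<Longrightarrow> Comp C (Ide C (Cod C f)) f = f"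
    and comp_assoc: "\<lbrakk>f \<in> Arr C; g \<in> Arr C; h \<in> Arr C; Dom C g = Cod C f; Dom C h = Cod C g\<rbrakk>
      \<Longrightarrow> Comp C h (Comp C g f) = Comp C (Comp C h g) f"

record ('o, 'a, 'p, 'b) ftor =
  ob :: "'o \<Rightarrow> 'p"
  ar :: "'a \<Rightarrow> 'b"

definition is_functor ::
    "('o, 'a) cat \<Rightarrow> ('p, 'b) cat \<Rightarrow> ('o, 'a, 'p, 'b) ftor \<Rightarrow> bool" where
  "is_functor C D F \<longleftrightarrow>
     (\<forall>x\<in>Obj C. ob F x \<in> Obj D) \<and>
     (\<forall>f\<in>Arr C. ar F f \<in> Arr D \<and> Dom D (ar F f) = ob F (Dom C f) \<and> Cod D (ar F f) = ob F (Cod C f)) \<and>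
     (\<forall>x\<in>Obj C. ar F (Ide C x) = Ide D (ob F x)) \<and>
     (\<forall>f\<in>Arr C. \<forall>g\<in>Arr C. Dom C g = Cod C f \<longrightarrow> ar F (Comp C g f) = Comp D (ar F g) (ar F f))"

definition comp_ftor ::
    "('p, 'b, 'q, 'c) ftor \<Rightarrow> ('o, 'a, 'p, 'b) ftor \<Rightarrow> ('o, 'a, 'q, 'c) ftor" where
  "comp_ftor G F = \<lparr>ob = ob G \<circ> ob F, ar = ar G \<circ> ar F\<rparr>"

text \<open>Equality of functors out of \<open>C\<close>: values outside the carriers of \<open>C\<close> are ignored.\<close>

definition eq_ftor ::
    "('o, 'a) cat \<Rightarrow> ('o, 'a, 'p, 'b) ftor \<Rightarrow> ('o, 'a, 'p, 'b) ftor \<Rightarrow> bool" where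
  "eq_ftor C F G \<longleftrightarrow> (\<forall>x\<in>Obj C. ob F x = ob G x) \<and> (\<forall>f\<in>Arr C. ar F f = ar G f)"

record ('o, 'a, 'x, 'b) over =
  Tot :: "('o, 'a) cat"
  Proj :: "('o, 'a, 'x, 'b) ftor"

definition category_over :: "('x, 'b) cat \<Rightarrow> ('o, 'a, 'x, 'b) over \<Rightarrow> bool" where
  "category_over X P \<longleftrightarrow> category (Tot P) \<and> is_functor (Tot P) X (Proj P)"

definition functor_over ::
    "('o, 'a, 'x, 'b) over \<Rightarrow> ('p, 'c, 'x, 'b) over \<Rightarrow> ('o, 'a, 'p, 'c) ftor \<Rightarrow> bool" where
  "functor_over P Q F \<longleftrightarrow>
     is_functor (Tot P) (Tot Q) F \<and> eq_ftor (Tot P) (comp_ftor (Proj Q) F) (Proj P)"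

definition discrete_fibration :: "('x, 'b) cat \<Rightarrow> ('o, 'a, 'x, 'b) over \<Rightarrow> bool" where
  "discrete_fibration X P \<longleftrightarrow> category_over X P \<and>
     (\<forall>a\<in>Obj (Tot P). \<forall>f\<in>Arr X. Cod X f = ob (Proj P) a \<longrightarrow>
        (\<exists>!u. u \<in> Arr (Tot P) \<and> Cod (Tot P) u = a \<and> ar (Proj P) u = f))"

definition discrete_opfibration :: "('x, 'b) cat \<Rightarrow> ('o, 'a, 'x, 'b) over \<Rightarrow> bool" where
  "discrete_opfibration X P \<longleftrightarrow> category_over X P \<and>
     (\<forall>a\<in>Obj (Tot P). \<forall>f\<in>Arr X. Dom X f = ob (Proj P) a \<longrightarrow>
        (\<exists>!u. u \<in> Arr (Tot P) \<and> Dom (Tot P) u = a \<and> ar (Proj P) u = f))"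

text \<open>
  \<open>is_reflection K P D \<eta>\<close>: the functor \<open>\<eta> : P \<rightarrow> D\<close> over the base is a universal arrow from \<open>P\<close>
  to the full subcategory of those categories over the base that satisfy \<open>K\<close>, i.e. \<open>D\<close>
  is the value at \<open>P\<close> of a left adjoint of the inclusion and \<open>\<eta>\<close> is the unit.

  The type \<open>'u\<close> plays the role of the universe: categories whose objects and arrows are taken
  from \<open>'u\<close> are the small ones.  Where \<open>'u\<close> is infinite, it has room for pairs and
  quotients, which is what the reflections in discrete (op)fibrations require.
\<close>

definition is_reflection ::
    "(('u, 'u, 'x, 'b) over \<Rightarrow> bool) \<Rightarrow> ('o, 'a, 'x, 'b) over \<Rightarrow> ('u, 'u, 'x, 'b) over
     \<Rightarrow> ('o, 'a, 'u, 'u) ftor \<Rightarrow> bool" where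
  "is_reflection K P D \<eta> \<longleftrightarrow> K D \<and> functor_over P D \<eta> \<and>
     (\<forall>E F. K E \<longrightarrow> functor_over P E F \<longrightarrow>
        (\<exists>G. functor_over D E G \<and> eq_ftor (Tot P) (comp_ftor G \<eta>) F \<and>
           (\<forall>G'. functor_over D E G' \<and> eq_ftor (Tot P) (comp_ftor G' \<eta>) F \<longrightarrow> eq_ftor (Tot D) G' G)))"

text \<open>
  The left adjoints are determined only up to isomorphism over \<open>X\<close>; a value is
  chosen for each \<open>P\<close>.
\<close>

definition down :: "('u, 'u) cat \<Rightarrow> ('o, 'a, 'u, 'u) over \<Rightarrow> ('u, 'u, 'u, 'u) over" where
  "down X P = (SOME D. \<exists>\<eta>. is_reflection (discrete_fibration X) P D \<eta>)"

definition up :: "('u, 'u) cat \<Rightarrow> ('o, 'a, 'u, 'u) over \<Rightarrow> ('u, 'u, 'u, 'u) over" where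
  "up X P = (SOME D. \<exists>\<eta>. is_reflection (discrete_opfibration X) P D \<eta>)"

definition one_cat :: "(unit, unit) cat" where
  "one_cat = \<lparr>Obj = {()}, Arr = {()}, Dom = (\<lambda>_. ()), Cod = (\<lambda>_. ()), Ide = (\<lambda>_. ()),
     Comp = (\<lambda>_ _. ())\<rparr>"

definition point :: "('x, 'b) cat \<Rightarrow> 'x \<Rightarrow> (unit, unit, 'x, 'b) over" where
  "point X x = \<lparr>Tot = one_cat, Proj = \<lparr>ob = (\<lambda>_. x), ar = (\<lambda>_. Ide X x)\<rparr>\<rparr>"

definition fiber :: "('o, 'a, 'x, 'b) over \<Rightarrow> 'x \<Rightarrow> 'o set" where
  "fiber A x = {a \<in> Obj (Tot A). ob (Proj A) a = x}"

definition prod_over ::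
    "('o, 'a, 'x, 'b) over \<Rightarrow> ('p, 'c, 'x, 'b) over \<Rightarrow> ('o \<times> 'p, 'a \<times> 'c, 'x, 'b) over" where
  "prod_over P Q =
     \<lparr>Tot = \<lparr>Obj = {(a, b). a \<in> Obj (Tot P) \<and> b \<in> Obj (Tot Q) \<and> ob (Proj P) a = ob (Proj Q) b},
             Arr = {(u, v). u \<in> Arr (Tot P) \<and> v \<in> Arr (Tot Q) \<and> ar (Proj P) u = ar (Proj Q) v},
             Dom = (\<lambda>(u, v). (Dom (Tot P) u, Dom (Tot Q) v)),
             Cod = (\<lambda>(u, v). (Cod (Tot P) u, Cod (Tot Q) v)),
             Ide = (\<lambda>(a, b). (Ide (Tot P) a, Ide (Tot Q) b)),
             Comp = (\<lambda>(u', v') (u, v). (Comp (Tot P) u' u, Comp (Tot Q) v' v))\<rparr>,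
      Proj = \<lparr>ob = (\<lambda>(a, b). ob (Proj P) a), ar = (\<lambda>(u, v). ar (Proj P) u)\<rparr>\<rparr>"

text \<open>Two objects lie in the same component iff a finite zigzag of arrows joins them.\<close>

definition components :: "('o, 'a) cat \<Rightarrow> 'o set set" where
  "components C =
     (let E = {(Dom C f, Cod C f) | f. f \<in> Arr C}
      in Obj C // ((E \<union> E\<inverse>)\<^sup>* \<inter> Obj C \<times> Obj C))"

definition ten :: "('o, 'a, 'x, 'b) over \<Rightarrow> ('p, 'c, 'x, 'b) over \<Rightarrow> ('o \<times> 'p) set set" where
  "ten P Q = components (Tot (prod_over P Q))"

end

(*
  Call (f, a) with f : x -> \<pi> a an element over x.  The elements over x are the objects of
  (x/X) \<times>_X P, and x/X is the reflection of the point x in discrete opfibrations because a functor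
  from it to a discrete opfibration is determined by the image of the identity of x, through
  opcartesian lifts.  Precomposition makes the sets of components of (x/X) \<times>_X P a presheaf on X;
  the corresponding discrete fibration is the reflection of P: a functor F from P to a
  discrete fibration sends (f, a) to the domain of the lift of f at F a, and this is constant on
  components.  Reflections being unique up to isomorphism over X, the first bijection follows for
  all choices; the second one is the first one for the opposite categories.
*)
theory Submission
  imports Defs
begin

section \<open>Zigzag components\<close>

text \<open>This names the relation under the quotient in \<open>components\<close>. Intersecting
  with pairs of objects matters because the reflexive transitive closure alone is reflexive on the
  whole type.\<close>

definition zigzag :: "('o, 'a) cat \<Rightarrow> ('o \<times> 'o) set" where
  "zigzag C = (let E = {(Dom C f, Cod C f) | f. f \<in> Arr C} in (E \<union> E\<inverse>)\<^sup>* \<inter> Obj C \<times> Obj C)"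

lemma components_eq: "components C = Obj C // zigzag C"
  by (simp add: components_def zigzag_def Let_def)

lemma equiv_zigzag: "equiv (Obj C) (zigzag C)"
proof (rule equivI)
  let ?E = "{(Dom C f, Cod C f) | f. f \<in> Arr C}"
  show "zigzag C \<subseteq> Obj C \<times> Obj C" by (auto simp: zigzag_def Let_def)
  show "refl_on (Obj C) (zigzag C)" by (auto simp: refl_on_def zigzag_def Let_def)
  have "sym ((?E \<union> ?E\<inverse>)\<^sup>*)" by (intro sym_rtrancl sym_Un_converse)
  then show "sym (zigzag C)" by (auto simp: zigzag_def Let_def sym_def)
  show "trans (zigzag C)" by (auto simp: zigzag_def Let_def trans_def)
qed

lemma zigzag_refl: "a \<in> Obj C \<Longrightarrow> (a, a) \<in> zigzag C"
  using equiv_zigzag by (metis equiv_def refl_onD)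

lemma zigzag_sym: "(a, b) \<in> zigzag C \<Longrightarrow> (b, a) \<in> zigzag C"
  using equiv_zigzag by (metis equiv_def symE)

lemma zigzag_trans: "(a, b) \<in> zigzag C \<Longrightarrow> (b, c) \<in> zigzag C \<Longrightarrow> (a, c) \<in> zigzag C"
  using equiv_zigzag by (metis equiv_def transE)

lemma zigzag_obj: "(a, b) \<in> zigzag C \<Longrightarrow> a \<in> Obj C \<and> b \<in> Obj C"
  by (auto simp: zigzag_def Let_def)

lemma zigzag_arr:
  assumes "f \<in> Arr C" "Dom C f \<in> Obj C" "Cod C f \<in> Obj C"
  shows "(Dom C f, Cod C f) \<in> zigzag C"
  using assms by (auto simp: zigzag_def Let_def)

text \<open>Induction along the zigzag: symmetry of \<open>R\<close> handles reversed arrows and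
  transitivity the concatenation. Since \<open>R\<close> is reflexive only on \<open>B\<close>, the
  empty zigzag needs \<open>h a \<in> B\<close>.\<close>

lemma zigzag_into:
  assumes "(a, b) \<in> zigzag C" and "equiv B R"
    and objs: "h a \<in> B"
    and arrs: "\<And>f. f \<in> Arr C \<Longrightarrow> (h (Dom C f), h (Cod C f)) \<in> R"
  shows "(h a, h b) \<in> R"
proof -
  let ?E = "{(Dom C f, Cod C f) | f. f \<in> Arr C}"
  have eq: "refl_on B R" "sym R" "trans R" using assms(2) by (auto simp: equiv_def)
  have "(a, b) \<in> (?E \<union> ?E\<inverse>)\<^sup>*" using assms(1) by (auto simp: zigzag_def Let_def)
  then show ?thesis
  proof (induction rule: rtrancl_induct)
    case base
    then show ?case using objs eq(1) by (auto dest: refl_onD)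
  next
    case (step y z)
    then have "(h y, h z) \<in> R" using arrs eq(2) by (auto dest: symD)
    then show ?case using step.IH eq(3) by (auto dest: transD)
  qed
qed

lemma zigzag_invariant:
  assumes "(a, b) \<in> zigzag C" and "\<And>f. f \<in> Arr C \<Longrightarrow> h (Dom C f) = h (Cod C f)"
  shows "h a = h b"
  using zigzag_into[where R = Id and B = UNIV and h = h, OF assms(1)] assms(2)
  by (auto simp: equiv_def refl_on_def sym_def trans_def)

text \<open>Each class goes to the class of the image of a chosen member \<open>s c\<close>; with
  the choice fixed, reflecting the relation is enough for injectivity.\<close>

lemma quotient_lepoll:
  assumes R: "equiv A R" and S: "equiv B S"
    and h: "\<And>a. a \<in> A \<Longrightarrow> h a \<in> B"
    and reflect: "\<And>a a'. \<lbrakk>a \<in> A; a' \<in> A; (h a, h a') \<in> S\<rbrakk> \<Longrightarrow> (a, a') \<in> R"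
  shows "A // R \<lesssim> B // S"
proof -
  define s where "s c = (SOME a. a \<in> c)" for c :: "'a set"
  have s: "s c \<in> c" "s c \<in> A" if "c \<in> A // R" for c
  proof -
    have "c \<noteq> {}" "c \<subseteq> A" using that in_quotient_imp_non_empty[OF R] in_quotient_imp_subset[OF R] by auto
    then show "s c \<in> c" "s c \<in> A" unfolding s_def using some_in_eq by blast+
  qed
  have "inj_on (\<lambda>c. S `` {h (s c)}) (A // R)"
  proof (rule inj_onI)
    fix c d assume cd: "c \<in> A // R" "d \<in> A // R" "S `` {h (s c)} = S `` {h (s d)}"
    then have "(h (s c), h (s d)) \<in> S" using eq_equiv_class[OF _ S] h s by metis
    then have "(s c, s d) \<in> R" using reflect s cd by metis
    then show "c = d" using quotient_eqI[OF R cd(1,2)] s cd by metis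
  qed
  moreover have "(\<lambda>c. S `` {h (s c)}) ` (A // R) \<subseteq> B // S"
    using h s by (auto intro: quotientI)
  ultimately show ?thesis unfolding lepoll_def by blast
qed

section \<open>Reflections are unique up to isomorphism\<close>

lemma functor_over_comp:
  assumes "functor_over P Q F" "functor_over Q R G"
  shows "functor_over P R (comp_ftor G F)"
  using assms unfolding functor_over_def is_functor_def comp_ftor_def eq_ftor_def by auto

lemma functor_over_id: "functor_over P P \<lparr>ob = id, ar = id\<rparr>"
  unfolding functor_over_def is_functor_def comp_ftor_def eq_ftor_def by auto

lemma functor_over_obj:
  assumes "functor_over P Q F" "a \<in> Obj (Tot P)"
  shows "ob F a \<in> Obj (Tot Q)" "ob (Proj Q) (ob F a) = ob (Proj P) a"
  using assms unfolding functor_over_def is_functor_def comp_ftor_def eq_ftor_def by auto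

lemma functor_over_arr:
  assumes "functor_over P Q F" "u \<in> Arr (Tot P)"
  shows "ar F u \<in> Arr (Tot Q)" "ar (Proj Q) (ar F u) = ar (Proj P) u"
    "Dom (Tot Q) (ar F u) = ob F (Dom (Tot P) u)" "Cod (Tot Q) (ar F u) = ob F (Cod (Tot P) u)"
  using assms unfolding functor_over_def is_functor_def comp_ftor_def eq_ftor_def by auto

text \<open>Both \<open>H\<close> and the identity factor \<open>\<eta>\<close> through itself, so
  uniqueness in the universal property identifies them on \<open>D\<close>.\<close>

lemma reflection_endo:
  assumes R: "is_reflection K P D \<eta>" and H: "functor_over D D H"
    and eq: "eq_ftor (Tot P) (comp_ftor H \<eta>) \<eta>" and d: "d \<in> Obj (Tot D)"
  shows "ob H d = d"
proof -
  have "K D" "functor_over P D \<eta>" using R by (auto simp: is_reflection_def)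
  then obtain G where G: "\<And>G'. functor_over D D G' \<Longrightarrow> eq_ftor (Tot P) (comp_ftor G' \<eta>) \<eta>
      \<Longrightarrow> eq_ftor (Tot D) G' G"
    using R unfolding is_reflection_def by metis
  have "eq_ftor (Tot D) H G" "eq_ftor (Tot D) \<lparr>ob = id, ar = id\<rparr> G"
    using G[OF H eq] G[OF functor_over_id] by (auto simp: eq_ftor_def comp_ftor_def)
  then show ?thesis using d by (auto simp: eq_ftor_def)
qed

text \<open>The two factorizations are mutually inverse by \<open>reflection_endo\<close>. The
  inverse laws are recorded on objects only, which is all that fibers and sets of components
  require.\<close>

lemma reflection_unique:
  assumes R: "is_reflection K P D \<eta>" and R': "is_reflection K P D' \<eta>'"
  obtains G G' where "functor_over D D' G" "functor_over D' D G'"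
    "\<And>d. d \<in> Obj (Tot D) \<Longrightarrow> ob G' (ob G d) = d"
    "\<And>d. d \<in> Obj (Tot D') \<Longrightarrow> ob G (ob G' d) = d"
proof -
  have K: "K D" "functor_over P D \<eta>" "K D'" "functor_over P D' \<eta>'"
    using R R' by (auto simp: is_reflection_def)
  obtain G where G: "functor_over D D' G" "eq_ftor (Tot P) (comp_ftor G \<eta>) \<eta>'"
    using R K unfolding is_reflection_def by metis
  obtain G' where G': "functor_over D' D G'" "eq_ftor (Tot P) (comp_ftor G' \<eta>') \<eta>"
    using R' K unfolding is_reflection_def by metis
  have "eq_ftor (Tot P) (comp_ftor (comp_ftor G' G) \<eta>) \<eta>"
    "eq_ftor (Tot P) (comp_ftor (comp_ftor G G') \<eta>') \<eta>'"
    using G(2) G'(2) by (auto simp: eq_ftor_def comp_ftor_def)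
  then have "ob (comp_ftor G' G) d = d" if "d \<in> Obj (Tot D)" for d
    using reflection_endo[OF R functor_over_comp[OF G(1) G'(1)]] that by blast
  moreover have "ob (comp_ftor G G') d = d" if "d \<in> Obj (Tot D')" for d
    using reflection_endo[OF R' functor_over_comp[OF G'(1) G(1)]] that
      \<open>eq_ftor (Tot P) (comp_ftor (comp_ftor G G') \<eta>') \<eta>'\<close> by blast
  ultimately show thesis using that[OF G(1) G'(1)] by (simp add: comp_ftor_def)
qed

lemma fiber_reflection_eqpoll:
  assumes "is_reflection K P D \<eta>" "is_reflection K P D' \<eta>'"
  shows "fiber D x \<approx> fiber D' x"
proof -
  obtain G G' where G: "functor_over D D' G" "functor_over D' D G'"
    "\<And>d. d \<in> Obj (Tot D) \<Longrightarrow> ob G' (ob G d) = d"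
    "\<And>d. d \<in> Obj (Tot D') \<Longrightarrow> ob G (ob G' d) = d"
    using reflection_unique[OF assms] by blast
  have "bij_betw (ob G) (fiber D x) (fiber D' x)"
    by (rule bij_betw_byWitness[where f' = "ob G'"])
      (use G functor_over_obj[OF G(1)] functor_over_obj[OF G(2)] in \<open>auto simp: fiber_def\<close>)
  then show ?thesis unfolding eqpoll_def by blast
qed

section \<open>Pullbacks over the base and invariance of \<open>ten\<close> under
  isomorphism\<close>

lemma obj_prod_over [simp]:
  "(a, b) \<in> Obj (Tot (prod_over P Q)) \<longleftrightarrow>
    a \<in> Obj (Tot P) \<and> b \<in> Obj (Tot Q) \<and> ob (Proj P) a = ob (Proj Q) b"
  by (simp add: prod_over_def)

lemma arr_prod_over [simp]:
  "(u, v) \<in> Arr (Tot (prod_over P Q)) \<longleftrightarrow>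
    u \<in> Arr (Tot P) \<and> v \<in> Arr (Tot Q) \<and> ar (Proj P) u = ar (Proj Q) v"
  by (simp add: prod_over_def)

lemma dom_cod_prod_over [simp]:
  "Dom (Tot (prod_over P Q)) (u, v) = (Dom (Tot P) u, Dom (Tot Q) v)"
  "Cod (Tot (prod_over P Q)) (u, v) = (Cod (Tot P) u, Cod (Tot Q) v)"
  by (simp_all add: prod_over_def)

lemma category_over_arrD:
  assumes "category_over X P" "u \<in> Arr (Tot P)"
  shows "Dom (Tot P) u \<in> Obj (Tot P)" "Cod (Tot P) u \<in> Obj (Tot P)"
    "ar (Proj P) u \<in> Arr X"
    "Dom X (ar (Proj P) u) = ob (Proj P) (Dom (Tot P) u)"
    "Cod X (ar (Proj P) u) = ob (Proj P) (Cod (Tot P) u)"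
  using assms category.dom_obj[of "Tot P"] category.cod_obj[of "Tot P"]
  unfolding category_over_def is_functor_def by auto

lemma prod_over_arr_obj:
  assumes "category_over X P" "category_over X Q" "w \<in> Arr (Tot (prod_over P Q))"
  shows "Dom (Tot (prod_over P Q)) w \<in> Obj (Tot (prod_over P Q))"
    "Cod (Tot (prod_over P Q)) w \<in> Obj (Tot (prod_over P Q))"
  using assms category_over_arrD[OF assms(1)] category_over_arrD[OF assms(2)]
  by (cases w; simp; metis)+

text \<open>\<open>G\<close> commutes with the projections, so pairing it with the identity of
  \<open>P\<close> sends arrows of one pullback to arrows of the other.\<close>

lemma zigzag_prod_map:
  assumes "category_over X U'" "category_over X P" and G: "functor_over U U' G"
    and z: "(c, d) \<in> zigzag (Tot (prod_over U P))"
  shows "(map_prod (ob G) id c, map_prod (ob G) id d) \<in> zigzag (Tot (prod_over U' P))"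
proof (rule zigzag_into[OF z equiv_zigzag])
  show "map_prod (ob G) id c \<in> Obj (Tot (prod_over U' P))"
    using zigzag_obj[OF z] functor_over_obj[OF G] by (cases c) auto
next
  fix w assume w: "w \<in> Arr (Tot (prod_over U P))"
  obtain u v where [simp]: "w = (u, v)" by (cases w)
  have "(ar G u, v) \<in> Arr (Tot (prod_over U' P))"
    using w functor_over_arr[OF G] by auto
  note zigzag_arr[OF this prod_over_arr_obj[OF assms(1,2) this]]
  then show "(map_prod (ob G) id (Dom (Tot (prod_over U P)) w),
      map_prod (ob G) id (Cod (Tot (prod_over U P)) w)) \<in> zigzag (Tot (prod_over U' P))"
    using w functor_over_arr[OF G] by auto
qed

lemma ten_retract_lepoll:
  assumes "category_over X U" "category_over X P"
    and G: "functor_over U U' G" and G': "functor_over U' U G'"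
    and inv: "\<And>d. d \<in> Obj (Tot U) \<Longrightarrow> ob G' (ob G d) = d"
  shows "ten U P \<lesssim> ten U' P"
  unfolding ten_def components_eq
proof (rule quotient_lepoll[OF equiv_zigzag equiv_zigzag, where h = "map_prod (ob G) id"])
  fix c assume "c \<in> Obj (Tot (prod_over U P))"
  then show "map_prod (ob G) id c \<in> Obj (Tot (prod_over U' P))"
    using functor_over_obj[OF G] by (cases c) auto
next
  fix c d assume c: "c \<in> Obj (Tot (prod_over U P))" "d \<in> Obj (Tot (prod_over U P))"
    and "(map_prod (ob G) id c, map_prod (ob G) id d) \<in> zigzag (Tot (prod_over U' P))"
  \<comment> \<open>The zigzag is carried back along \<open>G'\<close>; by \<open>inv\<close> its
    ends return to \<open>c\<close> and \<open>d\<close>.\<close>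
  from zigzag_prod_map[OF assms(1,2) G' this(3)] c
  show "(c, d) \<in> zigzag (Tot (prod_over U P))"
    by (cases c; cases d) (auto simp: inv)
qed

text \<open>Each comparison functor has the other as a retraction on objects, so there are
  injections both ways, and Schroeder-Bernstein gives the bijection.\<close>

lemma ten_reflection_eqpoll:
  assumes R: "is_reflection K Q U \<eta>" "is_reflection K Q U' \<eta>'"
    and K: "\<And>E. K E \<Longrightarrow> category_over X E" and P: "category_over X P"
  shows "ten U P \<approx> ten U' P"
proof -
  obtain G G' where G: "functor_over U U' G" "functor_over U' U G'"
    "\<And>d. d \<in> Obj (Tot U) \<Longrightarrow> ob G' (ob G d) = d"
    "\<And>d. d \<in> Obj (Tot U') \<Longrightarrow> ob G (ob G' d) = d"
    using reflection_unique[OF R] by blast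
  have "K U" "K U'" using R by (auto simp: is_reflection_def)
  then show ?thesis using G K P
    by (meson lepoll_antisym ten_retract_lepoll)
qed

section \<open>Duality\<close>

text \<open>Carriers and identities are kept, so the double opposite is an equality of records and
  the same functor data serve on both sides.\<close>

definition op_cat :: "('o, 'a) cat \<Rightarrow> ('o, 'a) cat" where
  "op_cat C = \<lparr>Obj = Obj C, Arr = Arr C, Dom = Cod C, Cod = Dom C, Ide = Ide C,
     Comp = (\<lambda>g f. Comp C f g)\<rparr>"

definition op_over :: "('o, 'a, 'x, 'b) over \<Rightarrow> ('o, 'a, 'x, 'b) over" where
  "op_over P = \<lparr>Tot = op_cat (Tot P), Proj = Proj P\<rparr>"

lemma op_cat_simps [simp]:
  "Obj (op_cat C) = Obj C" "Arr (op_cat C) = Arr C" "Dom (op_cat C) = Cod C"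
  "Cod (op_cat C) = Dom C" "Ide (op_cat C) = Ide C" "Comp (op_cat C) g f = Comp C f g"
  "op_cat (op_cat C) = C"
  by (simp_all add: op_cat_def)

lemma op_over_simps [simp]:
  "Tot (op_over P) = op_cat (Tot P)" "Proj (op_over P) = Proj P" "op_over (op_over P) = P"
  by (simp_all add: op_over_def)

lemma category_op: "category C \<Longrightarrow> category (op_cat C)"
  by (unfold_locales)
    (simp_all add: category.dom_obj category.cod_obj category.ide_arr category.dom_ide
      category.cod_ide category.comp_arr category.dom_comp category.cod_comp
      category.comp_ide_right category.comp_ide_left category.comp_assoc)

lemma category_op_iff [simp]: "category (op_cat C) \<longleftrightarrow> category C"
  using category_op[of C] category_op[of "op_cat C"] by auto

lemma is_functor_op [simp]: "is_functor (op_cat C) (op_cat D) F \<longleftrightarrow> is_functor C D F"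
  unfolding is_functor_def by auto

lemma eq_ftor_op [simp]: "eq_ftor (op_cat C) = eq_ftor C"
  by (simp add: eq_ftor_def fun_eq_iff)

lemma category_over_op [simp]: "category_over (op_cat X) (op_over P) \<longleftrightarrow> category_over X P"
  by (simp add: category_over_def)

lemma functor_over_op [simp]: "functor_over (op_over P) (op_over Q) F \<longleftrightarrow> functor_over P Q F"
  by (simp add: functor_over_def)

lemma discrete_fibration_op:
  "discrete_fibration (op_cat X) (op_over P) \<longleftrightarrow> discrete_opfibration X P"
  by (simp add: discrete_fibration_def discrete_opfibration_def)

lemma functor_over_op_left: "functor_over (op_over P) E F \<longleftrightarrow> functor_over P (op_over E) F"
  using functor_over_op[of P "op_over E" F] by simp

text \<open>Every test object \<open>E\<close> is the opposite of \<open>op_over E\<close>, so the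
  universal property transfers verbatim. Keeping \<open>K\<close> and \<open>K'\<close> abstract
  lets one lemma serve every exchange of fibrations and opfibrations.\<close>

lemma is_reflection_op:
  assumes R: "is_reflection K' P D \<eta>" and K: "\<And>E. K (op_over E) \<longleftrightarrow> K' E"
  shows "is_reflection K (op_over P) (op_over D) \<eta>"
  unfolding is_reflection_def
proof (intro conjI allI impI)
  show "K (op_over D)" "functor_over (op_over P) (op_over D) \<eta>"
    using R by (auto simp: is_reflection_def K)
next
  fix E F assume "K E" "functor_over (op_over P) E F"
  then have "K' (op_over E)" "functor_over P (op_over E) F"
    using K[of "op_over E"] by (auto simp: functor_over_op_left)
  then obtain G where "functor_over D (op_over E) G \<and> eq_ftor (Tot P) (comp_ftor G \<eta>) F \<and>
      (\<forall>G'. functor_over D (op_over E) G' \<and> eq_ftor (Tot P) (comp_ftor G' \<eta>) F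
        \<longrightarrow> eq_ftor (Tot D) G' G)"
    using R unfolding is_reflection_def by metis
  then show "\<exists>G. functor_over (op_over D) E G \<and> eq_ftor (Tot (op_over P)) (comp_ftor G \<eta>) F \<and>
      (\<forall>G'. functor_over (op_over D) E G' \<and> eq_ftor (Tot (op_over P)) (comp_ftor G' \<eta>) F
        \<longrightarrow> eq_ftor (Tot (op_over D)) G' G)"
    by (auto simp: functor_over_op_left)
qed

lemma point_op: "op_over (point X x) = point (op_cat X) x"
  by (simp add: op_over_def point_def one_cat_def op_cat_def)

lemma zigzag_op [simp]: "zigzag (op_cat C) = zigzag C"
proof -
  have "{(Cod C f, Dom C f) | f. f \<in> Arr C} = {(Dom C f, Cod C f) | f. f \<in> Arr C}\<inverse>" by auto
  then show ?thesis by (simp add: zigzag_def Let_def Un_commute)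
qed

text \<open>Pullbacks commute with opposites on the nose, and zigzags ignore the direction of
  arrows.\<close>

lemma ten_op: "ten (op_over P) (op_over Q) = ten P Q"
proof -
  have "prod_over (op_over P) (op_over Q) = op_over (prod_over P Q)"
    by (simp add: prod_over_def op_over_def op_cat_def fun_eq_iff)
  then show ?thesis by (simp add: ten_def components_eq)
qed

section \<open>Lifts in discrete fibrations\<close>

text \<open>Unique existence becomes a lifting function \<open>L\<close> with an existence rule and
  a recognition rule; later identities between lifts come from recognition.\<close>

lemma discrete_fibration_lift:
  assumes "discrete_fibration X E"
  obtains L where
    "\<And>e g. \<lbrakk>e \<in> Obj (Tot E); g \<in> Arr X; Cod X g = ob (Proj E) e\<rbrakk> \<Longrightarrow>
      L e g \<in> Arr (Tot E) \<and> Cod (Tot E) (L e g) = e \<and> ar (Proj E) (L e g) = g"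
    "\<And>u e g. \<lbrakk>u \<in> Arr (Tot E); Cod (Tot E) u = e; ar (Proj E) u = g\<rbrakk> \<Longrightarrow> L e g = u"
proof -
  define L where "L e g = (THE u. u \<in> Arr (Tot E) \<and> Cod (Tot E) u = e \<and> ar (Proj E) u = g)" for e g
  have ex1: "\<exists>!u. u \<in> Arr (Tot E) \<and> Cod (Tot E) u = e \<and> ar (Proj E) u = g"
    if "e \<in> Obj (Tot E)" "g \<in> Arr X" "Cod X g = ob (Proj E) e" for e g
    using assms that unfolding discrete_fibration_def by blast
  have E: "category_over X E" using assms by (simp add: discrete_fibration_def)
  show thesis
  proof (rule that)
    fix e g assume "e \<in> Obj (Tot E)" "g \<in> Arr X" "Cod X g = ob (Proj E) e"
    from theI'[OF ex1[OF this]]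
    show "L e g \<in> Arr (Tot E) \<and> Cod (Tot E) (L e g) = e \<and> ar (Proj E) (L e g) = g"
      by (simp add: L_def)
  next
    fix u e g assume u: "u \<in> Arr (Tot E)" "Cod (Tot E) u = e" "ar (Proj E) u = g"
    show "L e g = u" unfolding L_def
      by (rule the1_equality[OF ex1]) (use u category_over_arrD[OF E u(1)] in auto)
  qed
qed

lemma discrete_opfibration_lift:
  assumes "discrete_opfibration X E"
  obtains L where
    "\<And>e g. \<lbrakk>e \<in> Obj (Tot E); g \<in> Arr X; Dom X g = ob (Proj E) e\<rbrakk> \<Longrightarrow>
      L e g \<in> Arr (Tot E) \<and> Dom (Tot E) (L e g) = e \<and> ar (Proj E) (L e g) = g"
    "\<And>u e g. \<lbrakk>u \<in> Arr (Tot E); Dom (Tot E) u = e; ar (Proj E) u = g\<rbrakk> \<Longrightarrow> L e g = u"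
  using discrete_fibration_lift[of "op_cat X" "op_over E"] assms
  unfolding discrete_fibration_op by simp blast

section \<open>Coding pairs in the universe\<close>

text \<open>Reflections must have objects and arrows in \<open>'u\<close>, so pairs are packed into
  it by some injection; one exists because an infinite set is equipotent to its square.\<close>

definition enc :: "'u::infinite \<times> 'u \<Rightarrow> 'u" where
  "enc = (SOME e. inj e)"

definition dec :: "'u::infinite \<Rightarrow> 'u \<times> 'u" where
  "dec = inv enc"

lemma inj_enc: "inj (enc :: 'u::infinite \<times> 'u \<Rightarrow> 'u)"
  including cardinal_syntax
proof -
  have "|(UNIV :: 'u set) \<times> (UNIV :: 'u set)| =o |UNIV :: 'u set|"
    by (rule card_of_Times_same_infinite) (rule infinite_UNIV)
  then have "\<exists>e :: 'u \<times> 'u \<Rightarrow> 'u. inj e"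
    by (metis UNIV_Times_UNIV bij_betw_def card_of_ordIso)
  then show ?thesis unfolding enc_def by (rule someI_ex)
qed

lemma dec_enc [simp]: "dec (enc z) = z"
  unfolding dec_def by (rule inv_f_f[OF inj_enc])

lemma enc_eq_iff [simp]: "enc z = enc z' \<longleftrightarrow> z = z'"
  by (metis dec_enc)

section \<open>The coslice as the reflection of a point\<close>

text \<open>The code of \<open>(f, g)\<close> is the arrow \<open>g : f \<rightarrow> g \<circ> f\<close> of \<open>x/X\<close>.\<close>

definition coslice :: "('u::infinite, 'u) cat \<Rightarrow> 'u \<Rightarrow> ('u, 'u, 'u, 'u) over" where
  "coslice X x =
     \<lparr>Tot = \<lparr>Obj = {f \<in> Arr X. Dom X f = x},
             Arr = enc ` {(f, g). f \<in> Arr X \<and> g \<in> Arr X \<and> Dom X f = x \<and> Dom X g = Cod X f},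
             Dom = (\<lambda>w. fst (dec w)),
             Cod = (\<lambda>w. Comp X (snd (dec w)) (fst (dec w))),
             Ide = (\<lambda>f. enc (f, Ide X (Cod X f))),
             Comp = (\<lambda>w' w. enc (fst (dec w), Comp X (snd (dec w')) (snd (dec w))))\<rparr>,
      Proj = \<lparr>ob = Cod X, ar = (\<lambda>w. snd (dec w))\<rparr>\<rparr>"

lemma coslice_simps [simp]:
  "f \<in> Obj (Tot (coslice X x)) \<longleftrightarrow> f \<in> Arr X \<and> Dom X f = x"
  "enc (f, g) \<in> Arr (Tot (coslice X x)) \<longleftrightarrow>
    f \<in> Arr X \<and> g \<in> Arr X \<and> Dom X f = x \<and> Dom X g = Cod X f"
  "Dom (Tot (coslice X x)) (enc (f, g)) = f"
  "Cod (Tot (coslice X x)) (enc (f, g)) = Comp X g f"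
  "Ide (Tot (coslice X x)) f = enc (f, Ide X (Cod X f))"
  "Comp (Tot (coslice X x)) (enc (f', g')) (enc (f, g)) = enc (f, Comp X g' g)"
  "ob (Proj (coslice X x)) = Cod X"
  "ar (Proj (coslice X x)) (enc (f, g)) = g"
  by (auto simp: coslice_def)

lemma coslice_arrE:
  assumes "w \<in> Arr (Tot (coslice X x))"
  obtains f g where "w = enc (f, g)" "f \<in> Arr X" "g \<in> Arr X" "Dom X f = x" "Dom X g = Cod X f"
  using assms by (auto simp: coslice_def)

context category
begin

lemmas cat_simps = dom_obj cod_obj ide_arr dom_ide cod_ide comp_arr dom_comp cod_comp
  comp_ide_right comp_ide_left comp_assoc

text \<open>Stated with a separate \<open>x\<close> so that the simplifier can use it when the index
  of the identity is not literally \<open>Dom C f\<close>.\<close>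

lemma comp_ide_right': "\<lbrakk>f \<in> Arr C; Dom C f = x\<rbrakk> \<Longrightarrow> Comp C f (Ide C x) = f"
  using comp_ide_right by blast

lemma comp_ide_left': "\<lbrakk>f \<in> Arr C; Cod C f = x\<rbrakk> \<Longrightarrow> Comp C (Ide C x) f = f"
  using comp_ide_left by blast

end

lemma category_over_coslice:
  assumes "category X"
  shows "category_over X (coslice X x)"
proof -
  interpret category X by fact
  have "category (Tot (coslice X x))"
    by unfold_locales (auto elim!: coslice_arrE simp: cat_simps comp_ide_right' comp_ide_left')
  moreover have "is_functor (Tot (coslice X x)) X (Proj (coslice X x))"
    unfolding is_functor_def by (auto elim!: coslice_arrE simp: cat_simps)
  ultimately show ?thesis by (simp add: category_over_def)
qed

text \<open>The lift of \<open>g\<close> at \<open>f\<close> is the code of \<open>(f, g)\<close>: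
  an arrow is coded by its domain and the arrow below it, so uniqueness is immediate.\<close>

lemma discrete_opfibration_coslice:
  assumes "category X"
  shows "discrete_opfibration X (coslice X x)"
  unfolding discrete_opfibration_def
proof (intro conjI ballI impI category_over_coslice assms)
  fix f g assume "f \<in> Obj (Tot (coslice X x))" "g \<in> Arr X" "Dom X g = ob (Proj (coslice X x)) f"
  then show "\<exists>!u. u \<in> Arr (Tot (coslice X x)) \<and> Dom (Tot (coslice X x)) u = f \<and>
      ar (Proj (coslice X x)) u = g"
    by (intro ex1I[of _ "enc (f, g)"]) (auto elim!: coslice_arrE)
qed

lemma point_simps [simp]:
  "Obj (Tot (point X x)) = {()}" "Arr (Tot (point X x)) = {()}" "Dom (Tot (point X x)) u = ()"
  "Cod (Tot (point X x)) u = ()" "Ide (Tot (point X x)) a = ()" "Comp (Tot (point X x)) u v = ()"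
  "ob (Proj (point X x)) a = x" "ar (Proj (point X x)) u = Ide X x"
  by (simp_all add: point_def one_cat_def)

text \<open>A form of the Yoneda lemma, with the identity of \<open>x\<close> as universal
  element.\<close>

lemma reflection_coslice:
  fixes X :: "('u::infinite, 'u) cat"
  assumes "category X" and x: "x \<in> Obj X"
  shows "is_reflection (discrete_opfibration X) (point X x) (coslice X x)
    \<lparr>ob = (\<lambda>_. Ide X x), ar = (\<lambda>_. enc (Ide X x, Ide X x))\<rparr>"
    (is "is_reflection ?K ?P ?D ?\<eta>")
  unfolding is_reflection_def
proof (intro conjI allI impI)
  interpret category X by fact
  note [simp] = cat_simps comp_ide_right' comp_ide_left'
  show "?K ?D" by (rule discrete_opfibration_coslice[OF assms(1)])
  show "functor_over ?P ?D ?\<eta>"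
    using x by (auto simp: functor_over_def is_functor_def eq_ftor_def comp_ftor_def)
  fix E :: "('u, 'u, 'u, 'u) over" and F
  assume E: "?K E" and F: "functor_over ?P E F"
  interpret E: category "Tot E"
    using E by (simp add: discrete_opfibration_def category_over_def)
  have "category_over X E" using E by (simp add: discrete_opfibration_def)
  note E_arr = category_over_arrD[OF this]
  have E_fun: "is_functor (Tot E) X (Proj E)"
    using E by (simp add: discrete_opfibration_def category_over_def)
  obtain L where L: "\<And>e g. \<lbrakk>e \<in> Obj (Tot E); g \<in> Arr X; Dom X g = ob (Proj E) e\<rbrakk> \<Longrightarrow>
      L e g \<in> Arr (Tot E) \<and> Dom (Tot E) (L e g) = e \<and> ar (Proj E) (L e g) = g"
    and L_eq: "\<And>u e g. \<lbrakk>u \<in> Arr (Tot E); Dom (Tot E) u = e; ar (Proj E) u = g\<rbrakk> \<Longrightarrow> L e g = u"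
    by (rule discrete_opfibration_lift[OF E]) blast
  have L_ide: "L e (Ide X y) = Ide (Tot E) e" if "e \<in> Obj (Tot E)" "ob (Proj E) e = y" for e y
    using that E_fun by (intro L_eq) (auto simp: is_functor_def E.cat_simps)
  have L_cod: "Cod (Tot E) (L e g) \<in> Obj (Tot E)" "ob (Proj E) (Cod (Tot E) (L e g)) = Cod X g"
    if "e \<in> Obj (Tot E)" "g \<in> Arr X" "Dom X g = ob (Proj E) e" for e g
    using L[OF that] E_arr[of "L e g"] by auto
  \<comment> \<open>Lifting is functorial: the composite of the two lifts has the right domain and
    projection, so it is the lift of the composite.\<close>
  have L_comp: "L e (Comp X h g) = Comp (Tot E) (L (Cod (Tot E) (L e g)) h) (L e g)"
    if "e \<in> Obj (Tot E)" "g \<in> Arr X" "Dom X g = ob (Proj E) e" "h \<in> Arr X" "Dom X h = Cod X g"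
    for e g h
    using that L L_cod E_fun by (intro L_eq) (simp_all add: is_functor_def E.cat_simps)
  define e where "e = ob F ()"
  have e: "e \<in> Obj (Tot E)" "ob (Proj E) e = x"
    using functor_over_obj[OF F] by (auto simp: e_def)
  have Fu: "ar F () = Ide (Tot E) e"
    using F by (simp add: functor_over_def is_functor_def e_def)
  \<comment> \<open>An object \<open>f\<close> is transported from \<open>e\<close> along its lift;
    an arrow over \<open>g\<close> goes to the lift of \<open>g\<close> at the transported
    object.\<close>
  define G where "G = \<lparr>ob = (\<lambda>f. Cod (Tot E) (L e f)),
    ar = (\<lambda>w. L (Cod (Tot E) (L e (fst (dec w)))) (snd (dec w)))\<rparr>"
  have "functor_over ?D E G"
    unfolding functor_over_def is_functor_def eq_ftor_def
    using e by (auto elim!: coslice_arrE simp: G_def comp_ftor_def L L_cod L_ide L_comp E.cat_simps)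
  moreover have "eq_ftor (Tot ?P) (comp_ftor G ?\<eta>) F"
    using e x by (auto simp: eq_ftor_def comp_ftor_def G_def L_ide Fu E.cat_simps e_def[symmetric])
  moreover have "eq_ftor (Tot ?D) G' G"
    if G': "functor_over ?D E G'" "eq_ftor (Tot ?P) (comp_ftor G' ?\<eta>) F" for G'
  proof -
    have G'e: "ob G' (Ide X x) = e" using G'(2) by (simp add: eq_ftor_def comp_ftor_def e_def)
    have G'f: "ob G' f = Cod (Tot E) (L e f)" if "f \<in> Arr X" "Dom X f = x" for f
    proof -
      \<comment> \<open>Every object \<open>f\<close> is the codomain of this arrow out of the
        identity; \<open>G'\<close> must send it to the lift of \<open>f\<close> at
        \<open>e\<close>.\<close>
      have "enc (Ide X x, f) \<in> Arr (Tot ?D)" using that x by simp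
      note this functor_over_arr[OF G'(1) this]
      moreover from this have "L e f = ar G' (enc (Ide X x, f))"
        by (intro L_eq) (auto simp: G'e)
      ultimately show ?thesis using that by simp
    qed
    have "ar G' (enc (f, g)) = L (ob G' f) g" if "enc (f, g) \<in> Arr (Tot ?D)" for f g
      using functor_over_arr[OF G'(1) that] by (intro L_eq[symmetric]) auto
    then show ?thesis
      using G'f by (auto simp: eq_ftor_def G_def elim!: coslice_arrE)
  qed
  ultimately show "\<exists>G. functor_over ?D E G \<and> eq_ftor (Tot ?P) (comp_ftor G ?\<eta>) F \<and>
      (\<forall>G'. functor_over ?D E G' \<and> eq_ftor (Tot ?P) (comp_ftor G' ?\<eta>) F \<longrightarrow> eq_ftor (Tot ?D) G' G)"
    by blast
qed

section \<open>The reflection in discrete fibrations\<close>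

locale over_base = X: category X for X :: "('u::infinite, 'u) cat" +
  fixes P :: "('u, 'u, 'u, 'u) over"
  assumes P: "category_over X P"
begin

sublocale P: category "Tot P"
  using P by (simp add: category_over_def)

section \<open>Components of the pullbacks of \<open>P\<close> along coslices, as a presheaf\<close>

definition tot :: "'u \<Rightarrow> ('u \<times> 'u, 'u \<times> 'u) cat" where
  "tot x = Tot (prod_over (coslice X x) P)"

definition elt :: "'u \<Rightarrow> 'u \<Rightarrow> bool" where
  "elt f a \<longleftrightarrow> f \<in> Arr X \<and> a \<in> Obj (Tot P) \<and> Cod X f = ob (Proj P) a"

lemma obj_tot [simp]: "(f, a) \<in> Obj (tot x) \<longleftrightarrow> elt f a \<and> Dom X f = x"
  by (auto simp: tot_def elt_def)

text \<open>
  A component is represented by a chosen element of it, since the objects of the reflection have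
  to be taken from the universe.
\<close>

definition rep :: "'u \<times> 'u \<Rightarrow> 'u \<times> 'u" where
  "rep q = (SOME q'. (q, q') \<in> zigzag (tot (Dom X (fst q))))"

definition cls :: "'u \<Rightarrow> 'u \<Rightarrow> 'u" where
  "cls f a = enc (rep (f, a))"

lemma rep_zigzag: "elt f a \<Longrightarrow> ((f, a), rep (f, a)) \<in> zigzag (tot (Dom X f))"
  unfolding rep_def fst_conv by (rule someI[of _ "(f, a)"]) (simp add: zigzag_refl)

text \<open>Related elements lie over the same object and satisfy the same choice predicate, so
  \<open>SOME\<close> returns the same value for both.\<close>

lemma rep_eq:
  assumes "((f, a), (f', a')) \<in> zigzag (tot x)"
  shows "rep (f, a) = rep (f', a')"
proof -
  have "Dom X f = x" "Dom X f' = x" using zigzag_obj[OF assms] by auto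
  moreover have "((f, a), q) \<in> zigzag (tot x) \<longleftrightarrow> ((f', a'), q) \<in> zigzag (tot x)" for q
    using assms by (metis zigzag_sym zigzag_trans)
  ultimately show ?thesis by (simp add: rep_def)
qed

lemma cls_eq: "((f, a), (f', a')) \<in> zigzag (tot x) \<Longrightarrow> cls f a = cls f' a'"
  by (simp add: cls_def rep_eq)

text \<open>Decoding \<open>cls f a\<close> need not return \<open>(f, a)\<close>, only a
  representative of its component that represents itself. Arguments about decoded objects go through
  this pair.\<close>

lemma cls_canonical:
  assumes "elt f a"
  obtains f' a' where "cls f a = enc (f', a')" "elt f' a'" "cls f' a' = enc (f', a')"
    "Dom X f' = Dom X f" "((f, a), (f', a')) \<in> zigzag (tot (Dom X f))"
proof -
  obtain f' a' where r: "rep (f, a) = (f', a')" by (cases "rep (f, a)")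
  then have z: "((f, a), (f', a')) \<in> zigzag (tot (Dom X f))" using rep_zigzag[OF assms] by simp
  have "cls f a = enc (f', a')" by (simp add: cls_def r)
  moreover from this have "cls f' a' = enc (f', a')" using cls_eq[OF z] by simp
  moreover have "elt f' a'" "Dom X f' = Dom X f" using zigzag_obj[OF z] by auto
  ultimately show thesis using z that by blast
qed

text \<open>The arrow \<open>u\<close> and the coslice arrow over its projection starting at
  \<open>f\<close> form an arrow of \<open>tot\<close>. By \<open>tot_arrE\<close> every arrow of
  \<open>tot\<close> has this form.\<close>

lemma tot_zigzag_comp:
  assumes "u \<in> Arr (Tot P)" "elt f (Dom (Tot P) u)"
  shows "((f, Dom (Tot P) u), (Comp X (ar (Proj P) u) f, Cod (Tot P) u)) \<in> zigzag (tot (Dom X f))"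
proof -
  let ?w = "(enc (f, ar (Proj P) u), u)"
  have "?w \<in> Arr (tot (Dom X f))"
    using assms category_over_arrD[OF P assms(1)] by (simp add: tot_def elt_def)
  moreover from this have "Dom (tot (Dom X f)) ?w \<in> Obj (tot (Dom X f))"
    "Cod (tot (Dom X f)) ?w \<in> Obj (tot (Dom X f))"
    unfolding tot_def
    by (auto intro!: prod_over_arr_obj[OF category_over_coslice[OF X.category_axioms] P]
        simp del: dom_cod_prod_over)
  ultimately have "(Dom (tot (Dom X f)) ?w, Cod (tot (Dom X f)) ?w) \<in> zigzag (tot (Dom X f))"
    by (rule zigzag_arr)
  then show ?thesis by (simp add: tot_def)
qed

lemma tot_arrE:
  assumes "w \<in> Arr (tot x)"
  obtains f u where "Dom (tot x) w = (f, Dom (Tot P) u)"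
    "Cod (tot x) w = (Comp X (ar (Proj P) u) f, Cod (Tot P) u)"
    "u \<in> Arr (Tot P)" "elt f (Dom (Tot P) u)" "Dom X f = x"
proof -
  obtain v u where w: "w = (v, u)" by (cases w)
  obtain f where "v = enc (f, ar (Proj P) u)" "f \<in> Arr X" "Dom X f = x" "u \<in> Arr (Tot P)"
    "Cod X f = Dom X (ar (Proj P) u)"
    using assms unfolding tot_def w by (auto elim!: coslice_arrE)
  then show thesis
    using that[of f u] category_over_arrD[OF P, of u] by (simp add: tot_def w elt_def)
qed

lemma elt_comp: "\<lbrakk>elt f a; g \<in> Arr X; Cod X g = Dom X f\<rbrakk> \<Longrightarrow> elt (Comp X f g) a"
  by (auto simp: elt_def X.cat_simps)

text \<open>Associativity makes precomposition with \<open>g\<close> send generating arrows to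
  generating arrows; this is the action of the presheaf on components.\<close>

lemma zigzag_precomp:
  assumes z: "((f, a), (f', a')) \<in> zigzag (tot x)" and g: "g \<in> Arr X" "Cod X g = x"
  shows "((Comp X f g, a), (Comp X f' g, a')) \<in> zigzag (tot (Dom X g))"
proof -
  have "(map_prod (\<lambda>f. Comp X f g) id (f, a), map_prod (\<lambda>f. Comp X f g) id (f', a'))
    \<in> zigzag (tot (Dom X g))"
  proof (rule zigzag_into[OF z equiv_zigzag])
    show "map_prod (\<lambda>f. Comp X f g) id (f, a) \<in> Obj (tot (Dom X g))"
      using zigzag_obj[OF z] g by (auto simp: elt_comp elt_def X.cat_simps)
  next
    fix w assume "w \<in> Arr (tot x)"
    then obtain f u where w: "Dom (tot x) w = (f, Dom (Tot P) u)"
      "Cod (tot x) w = (Comp X (ar (Proj P) u) f, Cod (Tot P) u)"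
      "u \<in> Arr (Tot P)" "elt f (Dom (Tot P) u)" "Dom X f = x"
      by (rule tot_arrE)
    have "elt (Comp X f g) (Dom (Tot P) u)" using w g by (simp add: elt_comp)
    from tot_zigzag_comp[OF w(3) this]
    show "(map_prod (\<lambda>f. Comp X f g) id (Dom (tot x) w), map_prod (\<lambda>f. Comp X f g) id (Cod (tot x) w))
      \<in> zigzag (tot (Dom X g))"
      using w g category_over_arrD[OF P w(3)] by (simp add: X.cat_simps elt_def)
  qed
  then show ?thesis by simp
qed

text \<open>
  An arrow of the reflection is the code of a pair consisting of its codomain and the arrow of \<open>X\<close>
  below it.
\<close>

definition down_model :: "('u, 'u, 'u, 'u) over" where
  "down_model =
     \<lparr>Tot = \<lparr>Obj = {cls f a | f a. elt f a},
             Arr = {enc (cls f a, g) | f a g. elt f a \<and> g \<in> Arr X \<and> Cod X g = Dom X f},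
             Dom = (\<lambda>w. let (d, g) = dec w; (f, a) = dec d in cls (Comp X f g) a),
             Cod = (\<lambda>w. fst (dec w)),
             Ide = (\<lambda>d. enc (d, Ide X (Dom X (fst (dec d))))),
             Comp = (\<lambda>w' w. enc (fst (dec w'), Comp X (snd (dec w')) (snd (dec w))))\<rparr>,
      Proj = \<lparr>ob = (\<lambda>d. Dom X (fst (dec d))), ar = (\<lambda>w. snd (dec w))\<rparr>\<rparr>"

lemma down_model_objE:
  assumes "d \<in> Obj (Tot down_model)"
  obtains f a where "d = cls f a" "elt f a"
  using assms by (auto simp: down_model_def)

lemma down_model_arrE:
  assumes "w \<in> Arr (Tot down_model)"
  obtains f a g where "w = enc (cls f a, g)" "elt f a" "g \<in> Arr X" "Cod X g = Dom X f"
  using assms by (auto simp: down_model_def)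

lemma proj_cls [simp]: "elt f a \<Longrightarrow> Dom X (fst (dec (cls f a))) = Dom X f"
  by (erule cls_canonical) simp

lemma down_model_simps [simp]:
  "elt f a \<Longrightarrow> cls f a \<in> Obj (Tot down_model)"
  "\<lbrakk>elt f a; g \<in> Arr X; Cod X g = Dom X f\<rbrakk> \<Longrightarrow> enc (cls f a, g) \<in> Arr (Tot down_model)"
  "Cod (Tot down_model) (enc (d, g)) = d"
  "elt f a \<Longrightarrow> Ide (Tot down_model) (cls f a) = enc (cls f a, Ide X (Dom X f))"
  "Comp (Tot down_model) (enc (d', g')) (enc (d, g)) = enc (d', Comp X g' g)"
  "elt f a \<Longrightarrow> ob (Proj down_model) (cls f a) = Dom X f"
  "ar (Proj down_model) (enc (d, g)) = g"
  by (auto simp: down_model_def)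

text \<open>The domain is computed from the decoded representative; \<open>zigzag_precomp\<close>
  allows any element of the component in its place.\<close>

lemma down_model_dom [simp]:
  assumes "elt f a" "g \<in> Arr X" "Cod X g = Dom X f"
  shows "Dom (Tot down_model) (enc (cls f a, g)) = cls (Comp X f g) a"
proof -
  obtain f' a' where c: "cls f a = enc (f', a')" "((f, a), (f', a')) \<in> zigzag (tot (Dom X f))"
    by (rule cls_canonical[OF assms(1)])
  show ?thesis
    using cls_eq[OF zigzag_precomp[OF c(2) assms(2,3)]] by (simp add: down_model_def c(1))
qed

lemma category_over_down_model: "category_over X down_model"
proof -
  note [simp] = X.cat_simps elt_comp X.comp_ide_right' X.comp_ide_left'
  have elt_arr: "elt f a \<Longrightarrow> f \<in> Arr X" for f a by (simp add: elt_def)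
  \<comment> \<open>Composability in the model is an equation between classes; this extracts
    composability in \<open>X\<close> and the domain of the composite.\<close>
  have glue: "Dom X f = Dom X g' \<and>
      (\<forall>g\<in>Arr X. Cod X g = Dom X f \<longrightarrow> cls (Comp X (Comp X f' g') g) a' = cls (Comp X f g) a)"
    if c: "cls (Comp X f' g') a' = cls f a" and *: "elt f' a'" "elt f a" "g' \<in> Arr X" "Cod X g' = Dom X f'"
    for f a f' a' g'
  proof -
    have "Dom X f = Dom X g'"
      using c * proj_cls[of f a] proj_cls[of "Comp X f' g'" a'] by (simp add: elt_arr)
    moreover have "cls (Comp X (Comp X f' g') g) a' = cls (Comp X f g) a"
      if "g \<in> Arr X" "Cod X g = Dom X f" for g
      using that c * calculation down_model_dom[of f a g] down_model_dom[of "Comp X f' g'" a' g]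
      by (simp add: elt_arr)
    ultimately show ?thesis by blast
  qed
  have "category (Tot down_model)"
    by unfold_locales (auto elim!: down_model_arrE down_model_objE simp: elt_arr dest!: glue)
  moreover have "is_functor (Tot down_model) X (Proj down_model)"
    unfolding is_functor_def
    by (auto elim!: down_model_arrE down_model_objE simp: elt_arr dest!: glue)
  ultimately show ?thesis by (simp add: category_over_def)
qed

text \<open>The lift of \<open>g\<close> at \<open>d\<close> is the code of \<open>(d, g)\<close>,
  and the coding leaves no other candidate.\<close>

lemma discrete_fibration_down_model: "discrete_fibration X down_model"
  unfolding discrete_fibration_def
proof (intro conjI ballI impI category_over_down_model)
  fix d g assume d: "d \<in> Obj (Tot down_model)" "g \<in> Arr X" "Cod X g = ob (Proj down_model) d"
  then obtain f a where "d = cls f a" "elt f a" by (blast elim: down_model_objE)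
  then show "\<exists>!u. u \<in> Arr (Tot down_model) \<and> Cod (Tot down_model) u = d \<and> ar (Proj down_model) u = g"
    using d by (intro ex1I[of _ "enc (d, g)"]) (auto elim!: down_model_arrE)
qed

section \<open>The unit and the universal property of the model\<close>

definition down_unit :: "('u, 'u, 'u, 'u) ftor" where
  "down_unit = \<lparr>ob = (\<lambda>a. cls (Ide X (ob (Proj P) a)) a),
     ar = (\<lambda>u. enc (cls (Ide X (ob (Proj P) (Cod (Tot P) u))) (Cod (Tot P) u), ar (Proj P) u))\<rparr>"

lemma elt_ide: "a \<in> Obj (Tot P) \<Longrightarrow> elt (Ide X (ob (Proj P) a)) a"
  using P by (simp add: elt_def category_over_def is_functor_def X.cat_simps)

lemma functor_over_down_unit: "functor_over P down_model down_unit"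
proof -
  have obj: "ob (Proj P) a \<in> Obj X" if "a \<in> Obj (Tot P)" for a
    using P that by (simp add: category_over_def is_functor_def)
  \<comment> \<open>Compatibility of the unit with domains: \<open>u\<close> itself joins the
    identity element at its domain to the element given by its projection at its codomain.\<close>
  have nat: "cls (ar (Proj P) u) (Cod (Tot P) u) =
      cls (Ide X (ob (Proj P) (Dom (Tot P) u))) (Dom (Tot P) u)" if u: "u \<in> Arr (Tot P)" for u
    using cls_eq[OF tot_zigzag_comp[OF u elt_ide]] category_over_arrD[OF P u]
    by (simp add: X.comp_ide_right')
  show ?thesis
    unfolding functor_over_def is_functor_def eq_ftor_def
    using P category_over_arrD[OF P]
    by (auto simp: down_unit_def comp_ftor_def elt_ide obj nat X.cat_simps P.cat_simps X.comp_ide_left'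
        category_over_def is_functor_def)
qed

lemma is_reflection_down_model: "is_reflection (discrete_fibration X) P down_model down_unit"
  unfolding is_reflection_def
proof (intro conjI allI impI discrete_fibration_down_model functor_over_down_unit)
  fix E :: "('u, 'u, 'u, 'u) over" and F
  assume E: "discrete_fibration X E" and F: "functor_over P E F"
  note [simp] = X.cat_simps X.comp_ide_right' X.comp_ide_left' elt_comp
  have E_over: "category_over X E" using E by (simp add: discrete_fibration_def)
  interpret E: category "Tot E" using E_over by (simp add: category_over_def)
  note E_arr = category_over_arrD[OF E_over]
  have E_fun: "is_functor (Tot E) X (Proj E)" using E_over by (simp add: category_over_def)
  obtain L where L: "\<And>e g. \<lbrakk>e \<in> Obj (Tot E); g \<in> Arr X; Cod X g = ob (Proj E) e\<rbrakk> \<Longrightarrow>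
      L e g \<in> Arr (Tot E) \<and> Cod (Tot E) (L e g) = e \<and> ar (Proj E) (L e g) = g"
    and L_eq: "\<And>u e g. \<lbrakk>u \<in> Arr (Tot E); Cod (Tot E) u = e; ar (Proj E) u = g\<rbrakk> \<Longrightarrow> L e g = u"
    by (rule discrete_fibration_lift[OF E]) blast
  have L_ide: "L e (Ide X y) = Ide (Tot E) e" if "e \<in> Obj (Tot E)" "ob (Proj E) e = y" for e y
    using that E_fun by (intro L_eq) (auto simp: is_functor_def E.cat_simps)
  have L_dom: "Dom (Tot E) (L e g) \<in> Obj (Tot E)" "ob (Proj E) (Dom (Tot E) (L e g)) = Dom X g"
    if "e \<in> Obj (Tot E)" "g \<in> Arr X" "Cod X g = ob (Proj E) e" for e g
    using L[OF that] E_arr[of "L e g"] by auto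
  have L_comp: "L e (Comp X g h) = Comp (Tot E) (L e g) (L (Dom (Tot E) (L e g)) h)"
    if "e \<in> Obj (Tot E)" "g \<in> Arr X" "Cod X g = ob (Proj E) e" "h \<in> Arr X" "Cod X h = Dom X g"
    for e g h
    using that L L_dom E_fun by (intro L_eq) (simp_all add: is_functor_def E.cat_simps)
  have F_elt: "ob F a \<in> Obj (Tot E)" "f \<in> Arr X" "Cod X f = ob (Proj E) (ob F a)" if "elt f a" for f a
    using that functor_over_obj[OF F] by (auto simp: elt_def)
  define t where "t f a = Dom (Tot E) (L (ob F a) f)" for f a
  have t: "t f a \<in> Obj (Tot E)" "ob (Proj E) (t f a) = Dom X f" if "elt f a" for f a
    using L_dom[OF F_elt[OF that]] by (auto simp: t_def)
  \<comment> \<open>\<open>t\<close> turns precomposition into the action of \<open>E\<close> by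
    domains of lifts.\<close>
  have t_comp: "t (Comp X f g) a = Dom (Tot E) (L (t f a) g)"
    if "elt f a" "g \<in> Arr X" "Cod X g = Dom X f" for f a g
    using F_elt[OF that(1)] t[OF that(1)] that L L_dom
    by (simp add: t_def L_comp E.cat_simps)
  have t_zigzag: "t f a = t f' a'" if z: "((f, a), (f', a')) \<in> zigzag (tot x)" for f a f' a' x
  proof -
    have "case_prod t (f, a) = case_prod t (f', a')"
    proof (rule zigzag_invariant[OF z])
      fix w assume "w \<in> Arr (tot x)"
      then obtain f u where w: "Dom (tot x) w = (f, Dom (Tot P) u)"
        "Cod (tot x) w = (Comp X (ar (Proj P) u) f, Cod (Tot P) u)"
        "u \<in> Arr (Tot P)" "elt f (Dom (Tot P) u)" "Dom X f = x"
        by (rule tot_arrE)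
      \<comment> \<open>\<open>F\<close> preserves projections, so the image of \<open>u\<close> is
        itself a lift; with \<open>t_comp\<close> this makes \<open>t\<close> agree at both ends of
        an arrow of \<open>tot\<close>.\<close>
      have u: "L (ob F (Cod (Tot P) u)) (ar (Proj P) u) = ar F u"
        using functor_over_arr[OF F w(3)] by (intro L_eq) auto
      have "elt (ar (Proj P) u) (Cod (Tot P) u)"
        using category_over_arrD[OF P w(3)] by (simp add: elt_def)
      from t_comp[OF this, of f] have "t (Comp X (ar (Proj P) u) f) (Cod (Tot P) u) = t f (Dom (Tot P) u)"
        using w(3,4) category_over_arrD[OF P w(3)] functor_over_arr[OF F w(3)]
        by (simp add: t_def u elt_def)
      then show "case_prod t (Dom (tot x) w) = case_prod t (Cod (tot x) w)"
        by (simp add: w)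
    qed
    then show ?thesis by simp
  qed
  define G where "G = \<lparr>ob = (\<lambda>d. case_prod t (dec d)),
    ar = (\<lambda>w. L (case_prod t (dec (fst (dec w)))) (snd (dec w)))\<rparr>"
  have t_cls: "case_prod t (dec (cls f a)) = t f a" if fa: "elt f a" for f a
  proof -
    obtain f' a' where "cls f a = enc (f', a')" "((f, a), (f', a')) \<in> zigzag (tot (Dom X f))"
      by (rule cls_canonical[OF fa])
    then show ?thesis using t_zigzag by simp
  qed
  have G: "ob G (cls f a) = t f a" "ar G (enc (cls f a, g)) = L (t f a) g" if "elt f a" for f a g
    using t_cls[OF that] by (simp_all add: G_def)
  have glue: "Dom X f = Dom X g' \<and> t f a = Dom (Tot E) (L (t f' a') g')"
    if "cls (Comp X f' g') a' = cls f a" and *: "elt f' a'" "elt f a" "g' \<in> Arr X" "Cod X g' = Dom X f'"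
    for f a f' a' g'
    using that(1) * proj_cls[of f a] proj_cls[of "Comp X f' g'" a']
      t_cls[of f a] t_cls[of "Comp X f' g'" a'] by (simp add: F_elt(2) t_comp)
  have "functor_over down_model E G"
    unfolding functor_over_def is_functor_def eq_ftor_def
    by (auto elim!: down_model_arrE down_model_objE simp: comp_ftor_def G t L t_comp L_ide L_comp F_elt(2)
        dest!: glue)
  moreover have "eq_ftor (Tot P) (comp_ftor G down_unit) F"
  proof -
    have "t (Ide X (ob (Proj P) a)) a = ob F a" if "a \<in> Obj (Tot P)" for a
      using functor_over_obj[OF F that] by (simp add: t_def L_ide E.cat_simps)
    moreover have "L (ob F (Cod (Tot P) u)) (ar (Proj P) u) = ar F u" if "u \<in> Arr (Tot P)" for u
      using functor_over_arr[OF F that] by (intro L_eq) auto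
    ultimately show ?thesis
      by (auto simp: eq_ftor_def comp_ftor_def down_unit_def G elt_ide P.cat_simps)
  qed
  moreover have "eq_ftor (Tot down_model) G' G"
    if G': "functor_over down_model E G'" "eq_ftor (Tot P) (comp_ftor G' down_unit) F" for G'
  proof -
    have ob: "ob G' (cls f a) = t f a" if fa: "elt f a" for f a
    proof -
      have a: "a \<in> Obj (Tot P)" "Cod X f = ob (Proj P) a" "f \<in> Arr X"
        using fa by (auto simp: elt_def)
      \<comment> \<open>The object \<open>cls f a\<close> is the domain of the lift of
        \<open>f\<close> at the unit image of \<open>a\<close>. Hence \<open>G'\<close> sends this
        arrow to the lift of \<open>f\<close> at \<open>ob F a\<close>, which fixes its value
        there.\<close>
      let ?w = "enc (cls (Ide X (ob (Proj P) a)) a, f)"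
      have Obj: "ob (Proj P) a \<in> Obj X" using a X.cod_obj by metis
      have w: "?w \<in> Arr (Tot down_model)" "Dom (Tot down_model) ?w = cls f a"
        using a elt_ide[OF a(1)] Obj by simp_all
      have "ob G' (cls (Ide X (ob (Proj P) a)) a) = ob F a"
        using G'(2) a(1) by (simp add: eq_ftor_def comp_ftor_def down_unit_def)
      then have "L (ob F a) f = ar G' ?w"
        using functor_over_arr[OF G'(1) w(1)] by (intro L_eq) auto
      then show ?thesis using functor_over_arr[OF G'(1) w(1)] w(2) by (simp add: t_def)
    qed
    have "ar G' (enc (cls f a, g)) = L (t f a) g"
      if "elt f a" "g \<in> Arr X" "Cod X g = Dom X f" for f a g
      using functor_over_arr[OF G'(1), of "enc (cls f a, g)"] that
      by (intro L_eq[symmetric]) (auto simp: ob)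
    then show ?thesis
      by (auto simp: eq_ftor_def ob G elim!: down_model_arrE down_model_objE)
  qed
  ultimately show "\<exists>G. functor_over down_model E G \<and> eq_ftor (Tot P) (comp_ftor G down_unit) F \<and>
      (\<forall>G'. functor_over down_model E G' \<and> eq_ftor (Tot P) (comp_ftor G' down_unit) F
        \<longrightarrow> eq_ftor (Tot down_model) G' G)"
    by blast
qed

text \<open>Objects over \<open>x\<close> are the codes of chosen representatives, one for each
  component of \<open>tot x\<close>; decoding and taking the class is the bijection.\<close>

lemma fiber_down_model_eqpoll: "fiber down_model x \<approx> ten (coslice X x) P"
proof -
  let ?R = "zigzag (tot x)"
  have fiberE: "\<exists>f a. d = enc (f, a) \<and> cls f a = d \<and> (f, a) \<in> Obj (tot x)"
    if "d \<in> fiber down_model x" for d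
    using that unfolding fiber_def by (auto elim!: down_model_objE) (metis cls_canonical)
  have "bij_betw (\<lambda>d. ?R `` {dec d}) (fiber down_model x) (Obj (tot x) // ?R)"
    unfolding bij_betw_def
  proof (intro conjI inj_onI equalityI subsetI)
    fix d d' assume d: "d \<in> fiber down_model x" "d' \<in> fiber down_model x" "?R `` {dec d} = ?R `` {dec d'}"
    from fiberE[OF d(1)] fiberE[OF d(2)] obtain f a f' a' where
      e: "d = enc (f, a)" "cls f a = d" "d' = enc (f', a')" "cls f' a' = d'" "(f', a') \<in> Obj (tot x)"
      by blast
    then have "((f, a), (f', a')) \<in> ?R" using eq_equiv_class[OF d(3) equiv_zigzag] by simp
    then show "d = d'" using cls_eq e by metis
  next
    fix c assume "c \<in> (\<lambda>d. ?R `` {dec d}) ` fiber down_model x"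
    then show "c \<in> Obj (tot x) // ?R" using fiberE by (fastforce intro: quotientI)
  next
    fix c assume "c \<in> Obj (tot x) // ?R"
    then obtain f a where c: "c = ?R `` {(f, a)}" "elt f a" "Dom X f = x"
      by (auto elim!: quotientE)
    obtain f' a' where "cls f a = enc (f', a')" "((f, a), (f', a')) \<in> ?R"
      using cls_canonical[OF c(2)] c(3) by metis
    then have "c = ?R `` {dec (cls f a)}"
      using c(1) equiv_class_eq[OF equiv_zigzag] by simp
    then show "c \<in> (\<lambda>d. ?R `` {dec d}) ` fiber down_model x"
      using c by (auto simp: fiber_def)
  qed
  then show ?thesis by (auto simp: eqpoll_def ten_def components_eq tot_def)
qed

end

section \<open>Passage to arbitrary reflections and to the dual statement\<close>

text \<open>Stated for arbitrary reflections because the dual case applies it to opposites of the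
  chosen values of \<open>up\<close> and \<open>down\<close>, which need not be the values chosen
  for \<open>op_cat X\<close>.\<close>

lemma fiber_reflection_eqpoll_ten:
  fixes X :: "('u::infinite, 'u) cat" and P D U :: "('u, 'u, 'u, 'u) over"
  assumes "category X" "category_over X P" "x \<in> Obj X"
    and D: "is_reflection (discrete_fibration X) P D \<eta>"
    and U: "is_reflection (discrete_opfibration X) (point X x) U \<epsilon>"
  shows "fiber D x \<approx> ten U P"
proof -
  interpret over_base X P using assms(1,2) by (simp add: over_base_def over_base_axioms_def)
  have "fiber D x \<approx> fiber down_model x"
    by (rule fiber_reflection_eqpoll[OF D is_reflection_down_model])
  also have "\<dots> \<approx> ten (coslice X x) P" by (rule fiber_down_model_eqpoll)
  also have "\<dots> \<approx> ten U P"
    by (rule ten_reflection_eqpoll[OF reflection_coslice[OF assms(1,3)] U _ assms(2)])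
      (simp add: discrete_opfibration_def)
  finally show ?thesis .
qed

theorem proposition19:
  fixes X :: "('u::infinite, 'u) cat" and P :: "('u, 'u, 'u, 'u) over" and x :: 'u
  assumes "category X" and "category_over X P" and "x \<in> Obj X"
  shows "fiber (down X P) x \<approx> ten (up X (point X x)) P \<and>
         fiber (up X P) x \<approx> ten (down X (point X x)) P"
proof -
  let ?O = "op_cat X"
  have op: "category ?O" "category_over ?O (op_over P)" "x \<in> Obj ?O" using assms by simp_all
  have dual: "discrete_fibration ?O (op_over E) \<longleftrightarrow> discrete_opfibration X E"
    "discrete_fibration X (op_over E) \<longleftrightarrow> discrete_opfibration ?O E"
    "discrete_opfibration ?O (op_over E) \<longleftrightarrow> discrete_fibration X E"
    "discrete_opfibration X (op_over E) \<longleftrightarrow> discrete_fibration ?O E" for E :: "('u, 'u, 'u, 'u) over"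
    using discrete_fibration_op[of X] discrete_fibration_op[of ?O]
    by (metis op_cat_simps(7) op_over_simps(3))+
  \<comment> \<open>Existence of reflections is what makes the values picked by \<open>SOME\<close>
    reflections. It is stated for every base so that it also covers the opposite one.\<close>
  have down_P: "\<exists>(D :: ('u, 'u, 'u, 'u) over) \<eta>. is_reflection (discrete_fibration Y) Q D \<eta>"
    if "category Y" "category_over Y Q" for Y :: "('u, 'u) cat" and Q :: "('u, 'u, 'u, 'u) over"
    by (intro exI, rule over_base.is_reflection_down_model)
      (simp add: that over_base_def over_base_axioms_def)
  obtain \<eta>1 where 1: "is_reflection (discrete_fibration X) P (down X P) \<eta>1"
    unfolding down_def using someI_ex[OF down_P[OF assms(1,2)]] by blast
  obtain \<eta>2 where 2: "is_reflection (discrete_opfibration X) (point X x) (up X (point X x)) \<eta>2"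
    unfolding up_def
    using someI_ex[of "\<lambda>D. \<exists>\<eta>. is_reflection (discrete_opfibration X) (point X x) D \<eta>"]
      reflection_coslice[OF assms(1,3)] by blast
  obtain \<eta>3 where 3: "is_reflection (discrete_opfibration X) P (up X P) \<eta>3"
  proof -
    obtain D :: "('u, 'u, 'u, 'u) over" and \<eta>
      where "is_reflection (discrete_fibration ?O) (op_over P) D \<eta>"
      using down_P[OF op(1,2)] by blast
    from is_reflection_op[OF this, of "discrete_opfibration X"] dual
    have "\<exists>(D :: ('u, 'u, 'u, 'u) over) \<eta>. is_reflection (discrete_opfibration X) P D \<eta>" by auto
    from someI_ex[OF this] that show thesis unfolding up_def by blast
  qed
  obtain \<eta>4 where 4: "is_reflection (discrete_fibration X) (point X x) (down X (point X x)) \<eta>4"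
  proof -
    from is_reflection_op[OF reflection_coslice[OF op(1,3)], of "discrete_fibration X"] dual
    have "\<exists>(D :: ('u, 'u, 'u, 'u) over) \<eta>. is_reflection (discrete_fibration X) (point X x) D \<eta>"
      by (auto simp: point_op)
    from someI_ex[OF this] that show thesis unfolding down_def by blast
  qed
  \<comment> \<open>Over the opposite base the two reflections exchange roles, so this is the first
    bijection there; fibers and \<open>ten\<close> are unchanged by opposites.\<close>
  have "fiber (op_over (up X P)) x \<approx> ten (op_over (down X (point X x))) (op_over P)"
    using is_reflection_op[OF 3, of "discrete_fibration ?O"]
      is_reflection_op[OF 4, of "discrete_opfibration ?O"] dual
    by (intro fiber_reflection_eqpoll_ten[OF op]) (auto simp: point_op)
  then have "fiber (up X P) x \<approx> ten (down X (point X x)) P"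
    by (simp add: ten_op fiber_def)
  then show ?thesis
    using fiber_reflection_eqpoll_ten[OF assms 1 2] by blast
qed

end
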